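(* Let $\mathcal M=(\pi_0,K,g)$ be a state-space model on $\mathcal X\subseteq\mathbb R^{d_x}$ and let $y_{1:T}$ be an arbitrary but fixed data set. For $t=1,\dots,T$ let $g_t$ be positive, bounded, with $\log g_t$ differentiable, and let $$\alpha_t(x,\gamma)=x+\gamma\nabla\log g_t(x),\qquad x\in\mathcal X,\ \gamma\in[0,\Gamma_t],$$ where $\Gamma_t>0$ is such that $\alpha_t$ takes values in $\mathcal X$. Assume that for $t=1,\dots,T$: (a) $\nabla\log g_t$ is $L_t$-Lipschitz continuous, $L_t<\infty$: $\|\nabla\log g_t(x)-\nabla\log g_t(x')\|\le L_t\|x-x'\|$ for all $x,x'\in\mathbb R^{d_x}$; (b) there is a set $A_t\subseteq\mathcal X$ with $\xi_t(A_t)>0$ and $\nabla\log g_t(x)\ne0$ for all $x\in A_t$; (c) $K_t$ is continuous in total variation: for every $x\in\mathcal X$ and $\epsilon>0$ there is $\delta_{\epsilon,x,t}>0$ such that $\|K_t(x,\cdot)-K_t(x',\cdot)\|_{TV}\le\epsilon$ for all $x'\in\mathcal X$ with $\|x-x'\|\le\delta_{\epsilon,x,t}$. Then there exists a sequence of positive parameters $\gamma_{1:T}$ (depending on $\mathcal M$ and $y_{1:T}$) such that the nudged model $\mathcal M^\alpha$ constructed with the maps $\alpha_t(\cdot,\gamma_t)$ satisfies $$p_T(y_{1:T}\mid\mathcal M^\alpha)\ge p_T(y_{1:T}\mid\mathcal M).$$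
   Context: State-space model: $\mathcal X\subseteq\mathbb R^{d_x}$ is a Borel set. A state-space model $\mathcal M=(\pi_0,K,g)$ consists of a probability measure $\pi_0$ on $\mathcal X$, Markov kernels $K=\{K_t\}_{t\ge1}$ from $\mathcal X$ to $\mathcal X$, and likelihood functions $g_t(x)=g_t(y_t|x)\ge 0$, $t\ge1$, associated with the fixed observations $y_t$ (here defined on $\mathbb R^{d_x}$, so that the gradients make sense). Notation: $\mu(f)=\int f\,d\mu$, $K_t\pi(dx)=\int K_t(x',dx)\,\pi(dx')$. Recursively for $t\ge1$: predictive measures $\xi_t=K_t\pi_{t-1}$ and filters $\pi_t(f)=\xi_t(fg_t)/\xi_t(g_t)$; the Bayesian evidence is $p_T(y_{1:T}\mid\mathcal M)=\prod_{t=1}^T\xi_t(g_t)$. Total variation: $\|\mu\|_{TV}=|\sup_{F\in\mathcal B(\mathcal X)}\mu(F)-\inf_{F\in\mathcal B(\mathcal X)}\mu(F)|$. Nudged model: given $\gamma_{1:T}$ with $\gamma_t\in[0,\Gamma_t]$, $\mathcal M^\alpha=(\pi_0,K^\alpha,g)$ with $K_t^\alpha(x_{t-1},dx_t)=\int\delta_{\alpha_t(x_t',\gamma_t)}(dx_t)\,K_t(x_{t-1},dx_t')$, i.e. $K_t^\alpha(x,\cdot)$ is the image of $K_t(x,\cdot)$ under $\alpha_t(\cdot,\gamma_t)$; its evidence $p_T(y_{1:T}\mid\mathcal M^\alpha)=\prod_{t=1}^T\xi_t^\alpha(g_t)$ is defined through the same recursion with $K_t^\alpha$ in place of $K_t$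 and the same $\pi_0$ and $g$. *)

theory Defs
  imports "HOL-Probability.Probability"
begin

section \<open>State-space models\<close>

text \<open>
  The likelihoods are functions \<open>g t\<close> of the state only, since the observations are fixed. They are
  defined on the whole Euclidean space, although only their restrictions to \<open>X\<close> enter the model.
  The components \<open>K\<close> and \<open>g\<close> are indexed by \<open>t \<ge> 1\<close>; their values at \<open>0\<close> are irrelevant.
\<close>

locale state_space_model =
  fixes X :: "'a::euclidean_space set"
    and \<pi>0 :: "'a measure"
    and K :: "nat \<Rightarrow> 'a \<Rightarrow> 'a measure"
    and g :: "nat \<Rightarrow> 'a \<Rightarrow> real"
  assumes state_space_borel: "X \<in> sets borel"
    and initial_prob: "\<pi>0 \<in> space (prob_algebra (restrict_space borel X))"
    and markov_kernel:
      "\<And>t. 1 \<le> t \<Longrightarrow> K t \<in> restrict_space borel X \<rightarrow>\<^sub>M prob_algebra (restrict_space borel X)"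
    and likelihood_measurable: "\<And>t. 1 \<le> t \<Longrightarrow> g t \<in> borel_measurable (restrict_space borel X)"
    and likelihood_nonneg: "\<And>t x. 1 \<le> t \<Longrightarrow> 0 \<le> g t x"

text \<open>The measure \<open>\<pi>\<close> with \<open>\<pi>(f) = \<xi>(f h) / \<xi>(h)\<close>.\<close>

definition bayes_update :: "'a measure \<Rightarrow> ('a \<Rightarrow> real) \<Rightarrow> 'a measure" where
  "bayes_update \<xi> h = density \<xi> (\<lambda>x. ennreal (h x / (\<integral>z. h z \<partial>\<xi>)))"

primrec filter_measure ::
  "'a measure \<Rightarrow> (nat \<Rightarrow> 'a \<Rightarrow> 'a measure) \<Rightarrow> (nat \<Rightarrow> 'a \<Rightarrow> real) \<Rightarrow> nat \<Rightarrow> 'a measure" where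
  "filter_measure \<pi>0 K g 0 = \<pi>0"
| "filter_measure \<pi>0 K g (Suc t) =
     bayes_update (filter_measure \<pi>0 K g t \<bind> K (Suc t)) (g (Suc t))"

text \<open>Meaningful for \<open>t \<ge> 1\<close> only.\<close>

definition predictive_measure ::
  "'a measure \<Rightarrow> (nat \<Rightarrow> 'a \<Rightarrow> 'a measure) \<Rightarrow> (nat \<Rightarrow> 'a \<Rightarrow> real) \<Rightarrow> nat \<Rightarrow> 'a measure" where
  "predictive_measure \<pi>0 K g t = filter_measure \<pi>0 K g (t - 1) \<bind> K t"

definition evidence ::
  "'a measure \<Rightarrow> (nat \<Rightarrow> 'a \<Rightarrow> 'a measure) \<Rightarrow> (nat \<Rightarrow> 'a \<Rightarrow> real) \<Rightarrow> nat \<Rightarrow> real" where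
  "evidence \<pi>0 K g T = (\<Prod>t = 1..T. \<integral>x. g t x \<partial>(predictive_measure \<pi>0 K g t))"

section \<open>Total variation\<close>

text \<open>
  A finite signed measure is represented by its set function \<open>\<mu>\<close>, of which only the values on the
  sigma-algebra \<open>\<A>\<close> matter.
\<close>

definition tv_norm :: "'a set set \<Rightarrow> ('a set \<Rightarrow> real) \<Rightarrow> real" where
  "tv_norm \<A> \<mu> = \<bar>(SUP F\<in>\<A>. \<mu> F) - (INF F\<in>\<A>. \<mu> F)\<bar>"

section \<open>Gradient nudging\<close>

text \<open>Unspecified at points where \<open>f\<close> is not differentiable.\<close>

definition gradient :: "('a::euclidean_space \<Rightarrow> real) \<Rightarrow> 'a \<Rightarrow> 'a" where
  "gradient f x = (THE D. GDERIV f x :> D)"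

lemma gradient_eq: "GDERIV f x :> D \<Longrightarrow> gradient f x = D"
  unfolding gradient_def
proof (rule the_equality)
  fix D' assume "GDERIV f x :> D" "GDERIV f x :> D'"
  then have "(\<lambda>h. h \<bullet> D) = (\<lambda>h. h \<bullet> D')"
    unfolding gderiv_def by (rule has_derivative_unique)
  then have "(D' - D) \<bullet> (D' - D) = 0"
    by (simp add: inner_diff_right fun_eq_iff)
  then show "D' = D" by simp
qed

lemma differentiable_gradient:
  assumes "f differentiable (at x)"
  shows "GDERIV f x :> gradient f x"
proof -
  obtain f' where f': "(f has_derivative f') (at x)"
    using assms unfolding differentiable_def by blast
  interpret bounded_linear f' using f' by (rule has_derivative_bounded_linear)
  have "f' = (\<lambda>h. h \<bullet> (\<Sum>b\<in>Basis. f' b *\<^sub>R b))"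
  proof
    fix h
    have "f' h = f' (\<Sum>b\<in>Basis. (h \<bullet> b) *\<^sub>R b)" by (simp add: euclidean_representation)
    also have "\<dots> = (\<Sum>b\<in>Basis. (h \<bullet> b) * f' b)" by (simp add: sum scaleR)
    also have "\<dots> = h \<bullet> (\<Sum>b\<in>Basis. f' b *\<^sub>R b)" by (simp add: inner_sum_right mult.commute)
    finally show "f' h = h \<bullet> (\<Sum>b\<in>Basis. f' b *\<^sub>R b)" .
  qed
  then have "GDERIV f x :> (\<Sum>b\<in>Basis. f' b *\<^sub>R b)"
    using f' unfolding gderiv_def by simp
  then show ?thesis by (simp only: gradient_eq)
qed

definition gradient_nudge :: "(nat \<Rightarrow> 'a::euclidean_space \<Rightarrow> real) \<Rightarrow> nat \<Rightarrow> 'a \<Rightarrow> real \<Rightarrow> 'a" where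
  "gradient_nudge g t x \<gamma> = x + \<gamma> *\<^sub>R gradient (\<lambda>z. ln (g t z)) x"

definition nudged_kernel ::
  "'a::euclidean_space set \<Rightarrow> (nat \<Rightarrow> 'a \<Rightarrow> real \<Rightarrow> 'a) \<Rightarrow> (nat \<Rightarrow> real)
    \<Rightarrow> (nat \<Rightarrow> 'a \<Rightarrow> 'a measure) \<Rightarrow> nat \<Rightarrow> 'a \<Rightarrow> 'a measure" where
  "nudged_kernel X \<alpha> \<gamma> K t x = distr (K t x) (restrict_space borel X) (\<lambda>z. \<alpha> t z (\<gamma> t))"

end

theory Submission
  imports Defs
begin

text \<open>
  Write \<open>V\<^sub>k\<close> for the likelihood of the observations after time \<open>k\<close> as a function of the state at
  time \<open>k\<close>. For every \<open>k\<close> the evidence is \<open>(\<Prod>s<k. \<xi>\<^sub>s(g\<^sub>s)) * \<xi>\<^sub>k(g\<^sub>k V\<^sub>k)\<close>, and nudging at time \<open>k\<close> only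
  replaces \<open>g\<^sub>k V\<^sub>k\<close> by its composition with the nudge. As \<open>V\<^sub>T = 1\<close>, a gradient step of length at most
  \<open>1 / L\<^sub>T\<close> at time \<open>T\<close> strictly increases the evidence. Total variation continuity of the kernels makes
  \<open>V\<^sub>k\<close> continuous, so by dominated convergence the evidence depends continuously on \<open>\<gamma>\<^sub>k\<close> at \<open>0\<close> when the
  later parameters are held fixed. The parameters \<open>\<gamma>\<^sub>T, \<dots>, \<gamma>\<^sub>1\<close> can therefore be chosen one after the
  other, going backwards in time, without losing the strict increase.
\<close>

section \<open>Integrals against setwise and total variation continuous families of measures\<close>

text \<open>The sum counts the levels \<open>i / n\<close> not exceeding \<open>y\<close>, so it
  equals \<open>\<lfloor>n * y\<rfloor> / n\<close>. The bound \<open>y \<le> m\<close> ensures that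
  \<open>n * m\<close> levels reach up to \<open>y\<close>.\<close>

lemma layer_sum_approx:
  fixes f :: "'b \<Rightarrow> real" and m :: nat
  assumes "0 < n" "0 \<le> y" "y \<le> real m"
  shows "\<bar>y - (\<Sum>i = 1..n * m. if real i / real n \<le> y then 1 / real n else 0)\<bar> \<le> 1 / real n"
proof -
  define N where "N = nat \<lfloor>real n * y\<rfloor>"
  have "real n * y \<le> real n * real m" using assms by (intro mult_left_mono) auto
  then have le: "N \<le> n * m"
    unfolding N_def by (simp add: nat_le_iff floor_le_iff)
  have "real i / real n \<le> y \<longleftrightarrow> i \<le> N" for i
  proof -
    have "real i / real n \<le> y \<longleftrightarrow> real i \<le> real n * y"
      using \<open>0 < n\<close> by (simp add: divide_le_eq mult.commute)
    also have "\<dots> \<longleftrightarrow> int i \<le> \<lfloor>real n * y\<rfloor>" by (simp only: le_floor_iff of_int_of_nat_eq)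
    also have "\<dots> \<longleftrightarrow> i \<le> N" unfolding N_def using assms by (intro le_nat_iff[symmetric]) simp
    finally show ?thesis .
  qed
  then have "(\<Sum>i = 1..n * m. if real i / real n \<le> y then 1 / real n else 0)
      = (\<Sum>i = 1..n * m. if i \<le> N then 1 / real n else 0)"
    by (simp only:)
  also have "\<dots> = (\<Sum>i = 1..N. 1 / real n)"
    using le by (intro sum.mono_neutral_cong_right) auto
  also have "\<dots> = real N / real n" by simp
  also have "real N = of_int \<lfloor>real n * y\<rfloor>" unfolding N_def using assms by simp
  finally have eq: "(\<Sum>i = 1..n * m. if real i / real n \<le> y then 1 / real n else 0) = of_int \<lfloor>real n * y\<rfloor> / real n" .
  have "y - of_int \<lfloor>real n * y\<rfloor> / real n = (real n * y - of_int \<lfloor>real n * y\<rfloor>) / real n"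
    using assms by (simp add: field_simps)
  moreover have "0 \<le> real n * y - of_int \<lfloor>real n * y\<rfloor>" "real n * y - of_int \<lfloor>real n * y\<rfloor> \<le> 1"
    by linarith+
  ultimately show ?thesis unfolding eq using assms by (simp add: divide_right_mono)
qed

text \<open>The layer sums approximate \<open>f\<close> with an error that does not depend on the
  point. Since every \<open>Q x\<close> has total mass 1, the integrals are approximated uniformly
  in \<open>x\<close> by finite combinations of the continuous functions
  \<open>measure (Q x) F\<close>.\<close>

lemma continuous_on_integral_of_setwise:
  fixes Q :: "'a::topological_space \<Rightarrow> 'b measure" and f :: "'b \<Rightarrow> real"
  assumes prob: "\<And>x. x \<in> S \<Longrightarrow> prob_space (Q x)"
    and sets_Q: "\<And>x. x \<in> S \<Longrightarrow> sets (Q x) = sets N"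
    and cont: "\<And>F. F \<in> sets N \<Longrightarrow> continuous_on S (\<lambda>x. measure (Q x) F)"
    and f[measurable]: "f \<in> borel_measurable N"
    and nonneg: "\<And>y. y \<in> space N \<Longrightarrow> 0 \<le> f y"
    and bdd: "\<And>y. y \<in> space N \<Longrightarrow> f y \<le> C"
  shows "continuous_on S (\<lambda>x. \<integral>y. f y \<partial>Q x)"
proof -
  obtain m :: nat where m: "C \<le> real m" using real_arch_simple by blast
  txt \<open>\<open>f\<close> is the uniform limit of averages of indicators of its superlevel sets.\<close>
  define F where "F n i = {y \<in> space N. real i / real (Suc n) \<le> f y}" for n i
  have F[measurable]: "F n i \<in> sets N" for n i unfolding F_def by measurable
  define h where "h n x = (\<Sum>i = 1..Suc n * m. measure (Q x) (F n i) / real (Suc n))" for n x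
  have close: "\<bar>(\<integral>y. f y \<partial>Q x) - h n x\<bar> \<le> 1 / real (Suc n)" if x: "x \<in> S" for n x
  proof -
    interpret prob_space "Q x" using prob[OF x] .
    note [measurable_cong] = sets_Q[OF x]
    have sp: "space (Q x) = space N" using sets_eq_imp_space_eq[OF sets_Q[OF x]] .
    define s where "s y = (\<Sum>i = 1..Suc n * m. indicator (F n i) y / real (Suc n))" for y
    have int_s: "integrable (Q x) s" unfolding s_def
      by (intro Bochner_Integration.integrable_sum integrable_divide integrable_real_indicator) (auto simp: less_top[symmetric])
    have int_f: "integrable (Q x) f"
      by (rule integrable_const_bound[where B=C]) (use nonneg bdd in \<open>auto intro!: AE_I2 simp: sp\<close>)
    have "h n x = (\<integral>y. s y \<partial>Q x)" unfolding s_def h_def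
      by (subst Bochner_Integration.integral_sum)
         (auto simp: less_top[symmetric] sp Int_absorb2 sets.sets_into_space[OF F] intro!: integrable_divide integrable_real_indicator)
    then have "\<bar>(\<integral>y. f y \<partial>Q x) - h n x\<bar> = \<bar>\<integral>y. f y - s y \<partial>Q x\<bar>"
      using int_f int_s by simp
    also have "\<dots> \<le> (\<integral>y. \<bar>f y - s y\<bar> \<partial>Q x)" by (rule integral_abs_bound)
    also have "\<dots> \<le> (\<integral>y. 1 / real (Suc n) \<partial>Q x)"
    proof (rule integral_mono)
      fix y assume "y \<in> space (Q x)"
      then have y: "y \<in> space N" by (simp add: sp)
      have "s y = (\<Sum>i = 1..Suc n * m. if real i / real (Suc n) \<le> f y then 1 / real (Suc n) else 0)"
        unfolding s_def F_def using y by (intro sum.cong) (auto simp: indicator_def)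
      then show "\<bar>f y - s y\<bar> \<le> 1 / real (Suc n)"
        using layer_sum_approx[of "Suc n" "f y" m] nonneg[OF y] bdd[OF y] m by simp
    qed (use int_f int_s in auto)
    also have "\<dots> = 1 / real (Suc n)" by (simp add: prob_space)
    finally show ?thesis .
  qed
  have "uniform_limit S h (\<lambda>x. \<integral>y. f y \<partial>Q x) sequentially"
  proof (rule uniform_limitI)
    fix e :: real assume "0 < e"
    then have "\<forall>\<^sub>F n in sequentially. 1 / real (Suc n) < e"
      using LIMSEQ_inverse_real_of_nat order_tendstoD(2) by (fastforce simp: inverse_eq_divide)
    then show "\<forall>\<^sub>F n in sequentially. \<forall>x\<in>S. dist (h n x) (\<integral>y. f y \<partial>Q x) < e"
      by eventually_elim (metis close dist_commute dist_real_def order_le_less_trans)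
  qed
  moreover have "continuous_on S (h n)" for n
    unfolding h_def by (intro continuous_intros cont F) simp
  ultimately show ?thesis
    by (intro uniform_limit_theorem[where f=h and F=sequentially]) auto
qed

text \<open>The empty set has difference 0, so the supremum is nonnegative and the infimum
  nonpositive. Their difference therefore dominates both signs of the value at \<open>F\<close>. The
  bound by 1 makes both extrema genuine.\<close>

lemma measure_diff_le_tv_norm:
  assumes "prob_space \<mu>" "prob_space \<nu>" "{} \<in> \<A>" "F \<in> \<A>"
  shows "\<bar>measure \<mu> F - measure \<nu> F\<bar> \<le> tv_norm \<A> (\<lambda>F. measure \<mu> F - measure \<nu> F)"
proof -
  let ?d = "\<lambda>F. measure \<mu> F - measure \<nu> F"
  have b: "\<bar>?d G\<bar> \<le> 1" for G
    using prob_space.prob_le_1[OF assms(1), of G] prob_space.prob_le_1[OF assms(2), of G]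
      measure_nonneg[of \<mu> G] measure_nonneg[of \<nu> G] unfolding abs_le_iff by linarith
  have ba: "bdd_above (?d ` \<A>)" using b by (intro bdd_aboveI2[where M=1]) (simp add: abs_le_iff)
  have bb: "bdd_below (?d ` \<A>)" by (intro bdd_belowI2[where m="-1"]) (use b in \<open>auto simp: abs_le_iff algebra_simps\<close>)
  have "?d {} \<le> (SUP F\<in>\<A>. ?d F)" "?d F \<le> (SUP F\<in>\<A>. ?d F)"
    by (intro cSUP_upper ba assms)+
  moreover have "(INF F\<in>\<A>. ?d F) \<le> ?d {}" "(INF F\<in>\<A>. ?d F) \<le> ?d F"
    by (intro cINF_lower bb assms)+
  ultimately show ?thesis unfolding tv_norm_def by simp
qed

lemma setwise_continuous_of_tv:
  fixes Q :: "'a::real_normed_vector \<Rightarrow> 'b measure"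
  assumes prob: "\<And>x. x \<in> S \<Longrightarrow> prob_space (Q x)" and "{} \<in> \<A>" "F \<in> \<A>"
    and tv: "\<And>x \<epsilon>. x \<in> S \<Longrightarrow> 0 < \<epsilon> \<Longrightarrow> \<exists>\<delta>>0. \<forall>x'\<in>S. norm (x - x') \<le> \<delta> \<longrightarrow>
            tv_norm \<A> (\<lambda>F. measure (Q x) F - measure (Q x') F) \<le> \<epsilon>"
  shows "continuous_on S (\<lambda>x. measure (Q x) F)"
  unfolding continuous_on_iff
proof (intro ballI allI impI)
  fix x and e :: real assume x: "x \<in> S" and "0 < e"
  \<comment> \<open>Half of \<open>e\<close>, because the hypothesis yields a weak inequality and
    continuity asks for a strict one.\<close>
  then obtain \<delta> where \<delta>: "\<delta> > 0" "\<And>x'. x' \<in> S \<Longrightarrow> norm (x - x') \<le> \<delta> \<Longrightarrow>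
      tv_norm \<A> (\<lambda>F. measure (Q x) F - measure (Q x') F) \<le> e / 2"
    using tv[of x "e / 2"] by auto
  have "dist (measure (Q x') F) (measure (Q x) F) < e" if "x' \<in> S" "dist x' x < \<delta>" for x'
    using measure_diff_le_tv_norm[OF prob[OF x] prob[OF that(1)] assms(2,3)] \<delta>(2)[OF that(1)] that(2) \<open>0 < e\<close>
    by (simp add: dist_norm norm_minus_commute)
  then show "\<exists>d>0. \<forall>x'\<in>S. dist x' x < d \<longrightarrow> dist (measure (Q x') F) (measure (Q x) F) < e"
    using \<delta>(1) by blast
qed

section \<open>One step of gradient ascent\<close>

text \<open>By the mean value theorem the increment is \<open>\<gamma>\<close> times the inner
  product of the starting gradient with the gradient at an intermediate point. The two gradients
  differ by less than the norm of the first, so this product is positive.\<close>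

lemma gradient_ascent_less:
  fixes f :: "'a::euclidean_space \<Rightarrow> real"
  assumes diff: "\<And>z. f differentiable (at z)"
    and lip: "\<And>z z'. norm (gradient f z - gradient f z') \<le> L * norm (z - z')"
    and nz: "gradient f x \<noteq> 0" and "0 < \<gamma>" "\<gamma> * L \<le> 1"
  shows "f x < f (x + \<gamma> *\<^sub>R gradient f x)"
proof -
  define v where "v = gradient f x"
  have "((\<lambda>s. f (x + (s * \<gamma>) *\<^sub>R v)) has_derivative (\<lambda>h. ((h * \<gamma>) *\<^sub>R v) \<bullet> gradient f (x + (s * \<gamma>) *\<^sub>R v)))
      (at s within {0..1})" for s
  proof -
    have "((\<lambda>s. x + (s * \<gamma>) *\<^sub>R v) has_derivative (\<lambda>h. (h * \<gamma>) *\<^sub>R v)) (at s within {0..1})"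
      by (auto intro!: derivative_eq_intros)
    moreover have "(f has_derivative (\<lambda>h. h \<bullet> gradient f (x + (s * \<gamma>) *\<^sub>R v))) (at (x + (s * \<gamma>) *\<^sub>R v))"
      using differentiable_gradient[OF diff] unfolding gderiv_def .
    ultimately show ?thesis by (rule has_derivative_compose)
  qed
  from mvt_simple[OF zero_less_one this] obtain s where s: "0 < s" "s < 1"
    and eq: "f (x + \<gamma> *\<^sub>R v) - f x = \<gamma> * (v \<bullet> gradient f (x + (s * \<gamma>) *\<^sub>R v))"
    by auto
  let ?w = "gradient f (x + (s * \<gamma>) *\<^sub>R v)"
  have vpos: "0 < norm v" using nz by (simp add: v_def)
  have "norm (v - ?w) \<le> L * norm (x - (x + (s * \<gamma>) *\<^sub>R v))" unfolding v_def by (rule lip)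
  also have "\<dots> = s * (\<gamma> * L) * norm v" using s \<open>0 < \<gamma>\<close> by simp
  also have "\<dots> \<le> s * 1 * norm v" using s assms(5) by (intro mult_right_mono mult_left_mono) auto
  \<comment> \<open>Strictness comes from \<open>s < 1\<close>, so that a step with
    \<open>\<gamma> * L = 1\<close> is covered too.\<close>
  also have "\<dots> < norm v" using s vpos by simp
  finally have "norm v * norm (v - ?w) < norm v * norm v" using vpos by simp
  then have "v \<bullet> (v - ?w) < v \<bullet> v"
    using norm_cauchy_schwarz[of v "v - ?w"] by (simp add: power2_norm_eq_inner[symmetric] power2_eq_square)
  then have "0 < v \<bullet> ?w" by (simp add: inner_diff_right)
  with \<open>0 < \<gamma>\<close> have "0 < \<gamma> * (v \<bullet> ?w)" by simp
  with eq have "f x < f (x + \<gamma> *\<^sub>R v)" by linarith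
  then show ?thesis by (simp add: v_def)
qed

section \<open>Bounded integrands, Bayes updates and composition with kernels\<close>

lemma integrable_prob_algebra:
  fixes f :: "'b \<Rightarrow> real"
  assumes "N \<in> space (prob_algebra M)" "f \<in> borel_measurable M"
    and "\<And>x. x \<in> space M \<Longrightarrow> 0 \<le> f x" "\<And>x. x \<in> space M \<Longrightarrow> f x \<le> C"
  shows "integrable N f"
proof -
  have sets: "sets N = sets M" and "prob_space N" using assms(1) by (auto simp: space_prob_algebra)
  interpret prob_space N by fact
  have "f \<in> borel_measurable N" using assms(2) sets measurable_cong_sets by blast
  then show ?thesis using assms(3,4) sets_eq_imp_space_eq[OF sets]
    by (intro integrable_const_bound[where B=C]) (auto intro!: AE_I2)
qed

lemma integral_prob_algebra_pos:
  fixes f :: "'b \<Rightarrow> real"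
  assumes "N \<in> space (prob_algebra M)" "f \<in> borel_measurable M"
    and "\<And>x. x \<in> space M \<Longrightarrow> 0 < f x" "\<And>x. x \<in> space M \<Longrightarrow> f x \<le> C"
  shows "0 < (\<integral>x. f x \<partial>N)"
proof -
  have sets: "sets N = sets M" and "prob_space N" using assms(1) by (auto simp: space_prob_algebra)
  interpret prob_space N by fact
  have "integrable N f" using assms by (intro integrable_prob_algebra) (auto intro: less_imp_le)
  then have "(\<integral>x. 0 \<partial>N) < (\<integral>x. f x \<partial>N)"
    using assms(3) sets_eq_imp_space_eq[OF sets] emeasure_space_1
    by (intro integral_less_AE_space) auto
  then show ?thesis by simp
qed

text \<open>Recovers from the density encoding the formula
  \<open>\<pi>(f) = \<xi>(f h) / \<xi>(h)\<close> of the filter. If the normaliser is 0, both sides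
  are 0 by the convention for division.\<close>

lemma integral_bayes_update:
  fixes f h :: "'b \<Rightarrow> real"
  assumes "sets N = sets M" "h \<in> borel_measurable M" "f \<in> borel_measurable M"
    and "\<And>x. x \<in> space M \<Longrightarrow> 0 \<le> h x"
  shows "(\<integral>x. f x \<partial>bayes_update N h) = (\<integral>x. h x * f x \<partial>N) / (\<integral>x. h x \<partial>N)"
proof -
  note [measurable_cong] = assms(1) and [measurable] = assms(2,3)
  have sp: "space N = space M" using sets_eq_imp_space_eq[OF assms(1)] .
  have "0 \<le> (\<integral>x. h x \<partial>N)" using assms(4) by (intro integral_nonneg_AE) (auto simp: sp)
  then have "(\<integral>x. f x \<partial>bayes_update N h) = (\<integral>x. h x / (\<integral>x. h x \<partial>N) * f x \<partial>N)"
    unfolding bayes_update_def using assms(4)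
    by (intro integral_real_density) (auto simp: sp)
  then show ?thesis by simp
qed

lemma bayes_update_in_prob_algebra:
  fixes h :: "'b \<Rightarrow> real"
  assumes N: "N \<in> space (prob_algebra M)" and h: "h \<in> borel_measurable M"
    and "\<And>x. x \<in> space M \<Longrightarrow> 0 < h x" "\<And>x. x \<in> space M \<Longrightarrow> h x \<le> C"
  shows "bayes_update N h \<in> space (prob_algebra M)"
proof -
  let ?c = "\<integral>x. h x \<partial>N"
  have c: "0 < ?c" using assms by (rule integral_prob_algebra_pos)
  have sets: "sets N = sets M" using N by (simp add: space_prob_algebra)
  note sp = sets_eq_imp_space_eq[OF sets] and [measurable_cong] = sets and [measurable] = h
  have "integrable N h" using assms by (intro integrable_prob_algebra) (auto intro: less_imp_le)
  then have "(\<integral>\<^sup>+x. ennreal (h x / ?c) \<partial>N) = ennreal (\<integral>x. h x / ?c \<partial>N)"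
    using assms(3) c by (intro nn_integral_eq_integral) (auto simp: sp less_imp_le)
  also have "\<dots> = 1" using c by simp
  finally have "prob_space (bayes_update N h)"
    unfolding bayes_update_def by (intro prob_spaceI) (simp add: emeasure_density cong: nn_integral_cong)
  then show ?thesis by (simp add: space_prob_algebra bayes_update_def sets)
qed

text \<open>Passes through nonnegative extended integrals, where \<open>nn_integral_bind\<close>
  applies. Boundedness makes the inner integrals finite, which permits the return to real
  ones.\<close>

lemma integral_bind_nonneg:
  fixes f :: "'c \<Rightarrow> real"
  assumes N: "N \<in> space (prob_algebra M)" and Q: "Q \<in> M \<rightarrow>\<^sub>M prob_algebra R"
    and f: "f \<in> borel_measurable R"
    and "\<And>y. y \<in> space R \<Longrightarrow> 0 \<le> f y" "\<And>y. y \<in> space R \<Longrightarrow> f y \<le> C"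
  shows "(\<integral>y. f y \<partial>(N \<bind> Q)) = (\<integral>x. \<integral>y. f y \<partial>Q x \<partial>N)"
proof -
  have sets: "sets N = sets M" using N by (simp add: space_prob_algebra)
  note sp = sets_eq_imp_space_eq[OF sets]
  have QN: "Q \<in> N \<rightarrow>\<^sub>M prob_algebra R" using Q sets measurable_cong_sets by blast
  have Qx: "Q x \<in> space (prob_algebra R)" if "x \<in> space N" for x
    using measurable_space[OF QN that] .
  have nonneg: "0 \<le> f y" if "x \<in> space N" "y \<in> space (Q x)" for x y
    using Qx[OF that(1)] that(2) assms(4) by (auto simp: space_prob_algebra dest: sets_eq_imp_space_eq)
  have NQ: "sets (N \<bind> Q) = sets R" by (rule sets_bind'[OF N Q])
  have fm: "f \<in> borel_measurable (N \<bind> Q)" using f NQ measurable_cong_sets by blast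
  have im: "(\<lambda>x. \<integral>y. f y \<partial>Q x) \<in> borel_measurable N"
    using measurable_compose[OF measurable_prob_algebraD[OF QN] integral_measurable_subprob_algebra[OF f]] .
  have "(\<integral>y. f y \<partial>(N \<bind> Q)) = enn2real (\<integral>\<^sup>+y. ennreal (f y) \<partial>(N \<bind> Q))"
    using fm assms(4) sets_eq_imp_space_eq[OF NQ] by (intro integral_eq_nn_integral) (auto intro!: AE_I2)
  also have "(\<integral>\<^sup>+y. ennreal (f y) \<partial>(N \<bind> Q)) = (\<integral>\<^sup>+x. \<integral>\<^sup>+y. ennreal (f y) \<partial>Q x \<partial>N)"
    using f by (intro nn_integral_bind[OF _ measurable_prob_algebraD[OF QN]]) simp
  also have "\<dots> = (\<integral>\<^sup>+x. ennreal (\<integral>y. f y \<partial>Q x) \<partial>N)"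
    using integrable_prob_algebra[OF Qx f assms(4,5)] nonneg
    by (intro nn_integral_cong nn_integral_eq_integral) (auto intro!: AE_I2)
  also have "enn2real \<dots> = (\<integral>x. \<integral>y. f y \<partial>Q x \<partial>N)"
    using im nonneg by (intro integral_eq_nn_integral[symmetric]) (auto intro!: AE_I2 integral_nonneg_AE)
  finally show ?thesis .
qed

section \<open>Models with positive bounded likelihoods and their future likelihoods\<close>

text \<open>Conditional likelihood of the last \<open>n\<close> observations given the state at time \<open>T - n\<close>.\<close>

primrec future_likelihood ::
  "(nat \<Rightarrow> 'a \<Rightarrow> 'a measure) \<Rightarrow> (nat \<Rightarrow> 'a \<Rightarrow> real) \<Rightarrow> nat \<Rightarrow> nat \<Rightarrow> 'a \<Rightarrow> real" where
  "future_likelihood K g T 0 = (\<lambda>x. 1)"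
| "future_likelihood K g T (Suc n) =
     (\<lambda>x. \<integral>z. g (T - n) z * future_likelihood K g T n z \<partial>K (T - n) x)"

text \<open>The nudge at a single time, with an arbitrary map. Applying it at one time after another
  builds up \<open>nudged_kernel\<close>.\<close>

definition push_kernel_at ::
  "'a::topological_space set \<Rightarrow> nat \<Rightarrow> ('a \<Rightarrow> 'a) \<Rightarrow> (nat \<Rightarrow> 'a \<Rightarrow> 'a measure) \<Rightarrow> nat \<Rightarrow> 'a \<Rightarrow> 'a measure" where
  "push_kernel_at X k \<phi> K = K(k := \<lambda>x. distr (K k x) (restrict_space borel X) \<phi>)"

text \<open>\<open>T\<close> and \<open>B\<close> are parameters so that a model nudged at some
  times is an instance with the same bounds, and the results below can be reapplied to it.\<close>

locale positive_model = state_space_model X \<pi>0 K g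
  for X :: "'a::euclidean_space set" and \<pi>0 K g +
  fixes T :: nat and B :: "nat \<Rightarrow> real"
  assumes likelihood_pos: "\<And>t x. t \<in> {1..T} \<Longrightarrow> x \<in> X \<Longrightarrow> 0 < g t x"
    and likelihood_le: "\<And>t x. t \<in> {1..T} \<Longrightarrow> x \<in> X \<Longrightarrow> g t x \<le> B t"
begin

abbreviation "M \<equiv> restrict_space borel X"
abbreviation "flt \<equiv> filter_measure \<pi>0 K g"
abbreviation "prd \<equiv> predictive_measure \<pi>0 K g"
abbreviation "fut \<equiv> future_likelihood K g T"

lemma space_state_space [simp]: "space M = X"
  by (simp add: space_restrict_space)

lemma kernel_in_prob_algebra: "1 \<le> t \<Longrightarrow> x \<in> X \<Longrightarrow> K t x \<in> space (prob_algebra M)"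
  using measurable_space[OF markov_kernel, of t x] by simp

lemma kernel_space: "1 \<le> t \<Longrightarrow> x \<in> X \<Longrightarrow> space (K t x) = X"
  using kernel_in_prob_algebra[of t x] by (auto simp: space_prob_algebra dest: sets_eq_imp_space_eq)

lemma bind_in_prob_algebra:
  assumes "N \<in> space (prob_algebra M)" "1 \<le> t"
  shows "N \<bind> K t \<in> space (prob_algebra M)"
  using prob_space_bind'[OF assms(1) markov_kernel[OF assms(2)]]
    sets_bind'[OF assms(1) markov_kernel[OF assms(2)]] by (simp add: space_prob_algebra)

lemma filter_in_prob_algebra: "t \<le> T \<Longrightarrow> flt t \<in> space (prob_algebra M)"
proof (induction t)
  case 0
  show ?case using initial_prob by simp
next
  case (Suc t)
  then show ?case
    using likelihood_pos[of "Suc t"] likelihood_le[of "Suc t"]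
    by (auto intro!: bayes_update_in_prob_algebra[where C="B (Suc t)"] bind_in_prob_algebra likelihood_measurable)
qed

lemma predictive_in_prob_algebra: "t \<in> {1..T} \<Longrightarrow> prd t \<in> space (prob_algebra M)"
  unfolding predictive_measure_def by (intro bind_in_prob_algebra filter_in_prob_algebra) auto

lemma predictive_space: "t \<in> {1..T} \<Longrightarrow> space (prd t) = X"
  using predictive_in_prob_algebra[of t] by (auto simp: space_prob_algebra dest: sets_eq_imp_space_eq)

lemma predictive_likelihood_pos:
  assumes "t \<in> {1..T}"
  shows "0 < (\<integral>x. g t x \<partial>prd t)"
  using assms likelihood_pos[of t] likelihood_le[of t]
  by (intro integral_prob_algebra_pos[OF predictive_in_prob_algebra, where C="B t"] likelihood_measurable) auto

text \<open>Both properties go through one induction, since the bound at the next stage needs the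
  integrand to be integrable and hence measurable.\<close>

lemma future_likelihood_bounded_measurable:
  "n \<le> T \<Longrightarrow> fut n \<in> borel_measurable M \<and> (\<exists>C. \<forall>x\<in>X. 0 \<le> fut n x \<and> fut n x \<le> C)"
proof (induction n)
  case 0
  show ?case by auto
next
  case (Suc n)
  then obtain C where [measurable]: "fut n \<in> borel_measurable M"
    and C: "\<And>x. x \<in> X \<Longrightarrow> 0 \<le> fut n x \<and> fut n x \<le> C" by auto
  have t: "T - n \<in> {1..T}" using Suc.prems by auto
  then have [measurable]: "g (T - n) \<in> borel_measurable M" by (intro likelihood_measurable) auto
  let ?f = "\<lambda>z. g (T - n) z * fut n z"
  have bd: "0 \<le> ?f z \<and> ?f z \<le> B (T - n) * C" if "z \<in> X" for z
    using C[OF that] likelihood_pos[OF t that] likelihood_le[OF t that]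
    by (auto intro!: mult_mono mult_nonneg_nonneg)
  have "fut (Suc n) \<in> borel_measurable M"
    using measurable_compose[OF measurable_prob_algebraD[OF markov_kernel] integral_measurable_subprob_algebra,
      of "T - n" ?f] t by simp
  moreover have "0 \<le> fut (Suc n) x \<and> fut (Suc n) x \<le> B (T - n) * C" if x: "x \<in> X" for x
  proof -
    have Kx: "K (T - n) x \<in> space (prob_algebra M)" using t x by (intro kernel_in_prob_algebra) auto
    then interpret prob_space "K (T - n) x" by (simp add: space_prob_algebra)
    have sp: "space (K (T - n) x) = X" using t x by (intro kernel_space) auto
    have "integrable (K (T - n) x) ?f" using bd by (intro integrable_prob_algebra[OF Kx]) auto
    then show ?thesis using bd by (auto intro!: integral_nonneg_AE integral_le_const AE_I2 simp: sp)
  qed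
  ultimately show ?case by blast
qed

lemma future_likelihood_measurable: "n \<le> T \<Longrightarrow> fut n \<in> borel_measurable M"
  using future_likelihood_bounded_measurable by blast

lemma likelihood_future_bounded:
  assumes k: "k \<in> {1..T}"
  obtains C where "\<And>x. x \<in> X \<Longrightarrow> 0 \<le> g k x * fut (T - k) x" "\<And>x. x \<in> X \<Longrightarrow> g k x * fut (T - k) x \<le> C"
proof -
  obtain C where C: "\<And>x. x \<in> X \<Longrightarrow> 0 \<le> fut (T - k) x \<and> fut (T - k) x \<le> C"
    using future_likelihood_bounded_measurable[of "T - k"] by auto
  have "0 \<le> g k x * fut (T - k) x \<and> g k x * fut (T - k) x \<le> B k * C" if "x \<in> X" for x
    using C[OF that] likelihood_pos[OF k that] likelihood_le[OF k that]
    by (auto intro!: mult_mono mult_nonneg_nonneg)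
  then show ?thesis using that by blast
qed

lemma likelihood_future_measurable:
  "k \<in> {1..T} \<Longrightarrow> (\<lambda>x. g k x * fut (T - k) x) \<in> borel_measurable M"
  by (intro borel_measurable_times likelihood_measurable future_likelihood_measurable) auto

section \<open>Factorisation of the evidence around a fixed time\<close>

lemma integral_future_filter:
  assumes k: "k \<in> {1..T}"
  shows "(\<integral>x. fut (Suc (T - k)) x \<partial>flt (k - 1)) = (\<integral>x. g k x * fut (T - k) x \<partial>prd k)"
proof -
  obtain C where "\<And>x. x \<in> X \<Longrightarrow> 0 \<le> g k x * fut (T - k) x" "\<And>x. x \<in> X \<Longrightarrow> g k x * fut (T - k) x \<le> C"
    using likelihood_future_bounded[OF k] by blast
  \<comment> \<open>\<open>fut\<close> counts remaining observations, so the outermost kernel in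
    \<open>fut (Suc (T - k))\<close> is the one at time \<open>k\<close>.\<close>
  moreover have "T - (T - k) = k" using k by auto
  moreover have "k - 1 \<le> T" "1 \<le> k" using k by auto
  ultimately show ?thesis
    unfolding predictive_measure_def
    by (subst integral_bind_nonneg[OF filter_in_prob_algebra markov_kernel likelihood_future_measurable[OF k]]) auto
qed

text \<open>Backward induction from \<open>t = T\<close>, where the future likelihood is 1. Going
  from \<open>Suc t\<close> to \<open>t\<close>, the normaliser of the Bayes update cancels the
  factor of the product at \<open>Suc t\<close>, which is positive.\<close>

lemma evidence_eq_filter:
  assumes "t \<le> T"
  shows "evidence \<pi>0 K g T = (\<Prod>s = 1..t. \<integral>x. g s x \<partial>prd s) * (\<integral>x. fut (T - t) x \<partial>flt t)"
  using assms
proof (induction rule: inc_induct)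
  case base
  interpret prob_space "flt T" using filter_in_prob_algebra[of T] by (simp add: space_prob_algebra)
  show ?case by (simp add: evidence_def prob_space)
next
  case (step t)
  then have k: "Suc t \<in> {1..T}" by auto
  have prd: "prd (Suc t) \<in> space (prob_algebra M)" using predictive_in_prob_algebra[OF k] .
  have "(\<integral>x. fut (T - Suc t) x \<partial>flt (Suc t))
      = (\<integral>x. g (Suc t) x * fut (T - Suc t) x \<partial>prd (Suc t)) / (\<integral>x. g (Suc t) x \<partial>prd (Suc t))"
    using prd k likelihood_pos[OF k]
    by (subst filter_measure.simps(2))
       (auto simp: predictive_measure_def space_prob_algebra less_imp_le
         intro!: integral_bayes_update[where M=M] likelihood_measurable future_likelihood_measurable)
  then have "(\<integral>x. g (Suc t) x \<partial>prd (Suc t)) * (\<integral>x. fut (T - Suc t) x \<partial>flt (Suc t))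
      = (\<integral>x. fut (T - t) x \<partial>flt t)"
    using predictive_likelihood_pos[OF k] integral_future_filter[OF k] k
    by (simp add: Suc_diff_Suc[symmetric] del: Suc_diff_Suc)
  then show ?case using step.IH by (simp add: mult.assoc)
qed

text \<open>Isolates time \<open>k\<close>: the product involves only earlier kernels,
  \<open>fut (T - k)\<close> only later ones, and \<open>K k\<close> enters through
  \<open>prd k\<close> alone.\<close>

lemma evidence_eq_predictive:
  assumes k: "k \<in> {1..T}"
  shows "evidence \<pi>0 K g T
    = (\<Prod>s = 1..k - 1. \<integral>x. g s x \<partial>prd s) * (\<integral>x. g k x * fut (T - k) x \<partial>prd k)"
proof -
  have "k - 1 \<le> T" "T - (k - 1) = Suc (T - k)" using k by auto
  then show ?thesis using evidence_eq_filter[of "k - 1"] integral_future_filter[OF k] by simp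
qed

section \<open>Dependence on the kernels and the effect of changing one of them\<close>

lemma filter_cong:
  assumes "\<And>s x. s \<in> {1..t} \<Longrightarrow> x \<in> X \<Longrightarrow> K' s x = K s x" "t \<le> T"
  shows "filter_measure \<pi>0 K' g t = flt t"
  using assms
proof (induction t)
  case (Suc t)
  have "space (flt t) = X"
    using filter_in_prob_algebra[of t] Suc.prems by (auto simp: space_prob_algebra dest: sets_eq_imp_space_eq)
  then have "flt t \<bind> K' (Suc t) = flt t \<bind> K (Suc t)"
    using Suc.prems by (intro bind_cong) auto
  then show ?case using Suc by simp
qed simp

lemma predictive_cong:
  assumes "\<And>s x. s \<in> {1..t} \<Longrightarrow> x \<in> X \<Longrightarrow> K' s x = K s x" "t \<in> {1..T}"
  shows "predictive_measure \<pi>0 K' g t = prd t"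
proof -
  have "space (flt (t - 1)) = X"
    using filter_in_prob_algebra[of "t - 1"] assms by (fastforce simp: space_prob_algebra dest: sets_eq_imp_space_eq)
  then have "flt (t - 1) \<bind> K' t = flt (t - 1) \<bind> K t"
    using assms by (intro bind_cong) auto
  moreover have "filter_measure \<pi>0 K' g (t - 1) = flt (t - 1)"
    using assms(2) by (intro filter_cong assms(1)) auto
  ultimately show ?thesis unfolding predictive_measure_def by simp
qed

lemma evidence_cong:
  assumes "\<And>s x. s \<in> {1..T} \<Longrightarrow> x \<in> X \<Longrightarrow> K' s x = K s x"
  shows "evidence \<pi>0 K' g T = evidence \<pi>0 K g T"
  unfolding evidence_def using assms by (intro prod.cong refl) (subst predictive_cong, auto)

lemma future_likelihood_cong:
  assumes "\<And>s x. s \<in> {T - n<..T} \<Longrightarrow> x \<in> X \<Longrightarrow> K' s x = K s x" "n \<le> T" "x \<in> X"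
  shows "future_likelihood K' g T n x = fut n x"
  using assms
proof (induction n arbitrary: x)
  case (Suc n)
  have "space (K (T - n) x) = X" using Suc.prems by (intro kernel_space) auto
  moreover have "K' (T - n) x = K (T - n) x" using Suc.prems by (intro Suc.prems(1)) auto
  moreover have "future_likelihood K' g T n z = fut n z" if "z \<in> X" for z
    using Suc.prems that by (intro Suc.IH) auto
  ultimately show ?case by (auto intro!: Bochner_Integration.integral_cong)
qed simp

lemma push_kernel_at_model:
  assumes \<phi>: "\<phi> \<in> M \<rightarrow>\<^sub>M M"
  shows "positive_model X \<pi>0 (push_kernel_at X k \<phi> K) g T B"
proof unfold_locales
  fix t :: nat assume t: "1 \<le> t"
  show "push_kernel_at X k \<phi> K t \<in> M \<rightarrow>\<^sub>M prob_algebra M"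
    using measurable_compose[OF markov_kernel[OF t] measurable_distr_prob_space[OF \<phi>]] markov_kernel[OF t]
    by (auto simp: push_kernel_at_def)
qed (use state_space_borel initial_prob likelihood_measurable likelihood_nonneg likelihood_pos likelihood_le in auto)

text \<open>The filter before time \<open>k\<close> and the future likelihood after it are
  unchanged, while the predictive measure at \<open>k\<close> becomes its image under
  \<open>\<phi>\<close>. A change of variables moves \<open>\<phi>\<close> into the
  integrand.\<close>

lemma evidence_push_kernel_at:
  assumes k: "k \<in> {1..T}" and \<phi>: "\<phi> \<in> M \<rightarrow>\<^sub>M M"
  shows "evidence \<pi>0 (push_kernel_at X k \<phi> K) g T
    = (\<Prod>s = 1..k - 1. \<integral>x. g s x \<partial>prd s) * (\<integral>x. g k (\<phi> x) * fut (T - k) (\<phi> x) \<partial>prd k)"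
proof -
  let ?K = "push_kernel_at X k \<phi> K"
  interpret P: positive_model X \<pi>0 ?K g T B by (rule push_kernel_at_model[OF \<phi>])
  have prd: "predictive_measure \<pi>0 ?K g s = prd s" if "s \<in> {1..k - 1}" for s
    using that k by (intro predictive_cong) (auto simp: push_kernel_at_def)
  have flt: "filter_measure \<pi>0 ?K g (k - 1) = flt (k - 1)"
    using k by (intro filter_cong) (auto simp: push_kernel_at_def)
  have fl: "flt (k - 1) \<in> space (prob_algebra M)" using k by (intro filter_in_prob_algebra) auto
  then have setsf: "sets (flt (k - 1)) = sets M" by (simp add: space_prob_algebra)
  have "K k \<in> flt (k - 1) \<rightarrow>\<^sub>M subprob_algebra M"
    using measurable_prob_algebraD[OF markov_kernel[of k]] k setsf measurable_cong_sets by auto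
  moreover have "space (flt (k - 1)) \<noteq> {}"
    using fl prob_space.not_empty by (auto simp: space_prob_algebra)
  ultimately have prdk: "predictive_measure \<pi>0 ?K g k = distr (prd k) M \<phi>"
    unfolding predictive_measure_def flt using \<phi> by (subst distr_bind) (auto simp: push_kernel_at_def)
  have fut: "future_likelihood ?K g T (T - k) x = fut (T - k) x" if "x \<in> X" for x
    using that k by (intro future_likelihood_cong) (auto simp: push_kernel_at_def)
  have "sets (prd k) = sets M" using predictive_in_prob_algebra[OF k] by (simp add: space_prob_algebra)
  then have \<phi>': "\<phi> \<in> prd k \<rightarrow>\<^sub>M M" using \<phi> measurable_cong_sets by blast
  have "(\<integral>x. g k x * future_likelihood ?K g T (T - k) x \<partial>distr (prd k) M \<phi>)
      = (\<integral>x. g k x * fut (T - k) x \<partial>distr (prd k) M \<phi>)"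
    by (intro Bochner_Integration.integral_cong) (auto simp: fut)
  also have "\<dots> = (\<integral>x. g k (\<phi> x) * fut (T - k) (\<phi> x) \<partial>prd k)"
    by (rule integral_distr[OF \<phi>' likelihood_future_measurable[OF k]])
  finally show ?thesis using P.evidence_eq_predictive[OF k] by (simp add: prd prdk)
qed

section \<open>Continuity of the evidence in a nudge, and strict gain at the last time\<close>

text \<open>A case distinction suffices: for \<open>n > 0\<close> the function is an integral of a
  bounded measurable integrand against a setwise continuous kernel.\<close>

lemma continuous_on_future_likelihood:
  assumes cont: "\<And>t F. t \<in> {1..T} \<Longrightarrow> F \<in> sets M \<Longrightarrow> continuous_on X (\<lambda>x. measure (K t x) F)"
    and "n \<le> T"
  shows "continuous_on X (fut n)"
proof (cases n)
  case (Suc m)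
  then have t: "T - m \<in> {1..T}" "T - (T - m) = m" using assms(2) by auto
  obtain C where "\<And>x. x \<in> X \<Longrightarrow> 0 \<le> g (T - m) x * fut m x" "\<And>x. x \<in> X \<Longrightarrow> g (T - m) x * fut m x \<le> C"
    using likelihood_future_bounded[OF t(1)] t(2) by metis
  then have "continuous_on X (\<lambda>x. \<integral>z. g (T - m) z * fut m z \<partial>K (T - m) x)"
    using cont[OF t(1)] likelihood_future_measurable[OF t(1)] kernel_in_prob_algebra[of "T - m"] t
    by (intro continuous_on_integral_of_setwise[where N=M and C=C]) (auto simp: space_prob_algebra)
  then show ?thesis using Suc by simp
qed simp

text \<open>Only the integrand against the fixed probability measure \<open>prd k\<close> varies,
  and a constant dominates it.\<close>

lemma evidence_push_kernel_at_tendsto: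
  assumes k: "k \<in> {1..T}"
    and cont: "\<And>t F. t \<in> {1..T} \<Longrightarrow> F \<in> sets M \<Longrightarrow> continuous_on X (\<lambda>x. measure (K t x) F)"
    and g: "continuous_on X (g k)"
    and \<phi>: "\<And>n. \<phi> n \<in> M \<rightarrow>\<^sub>M M" and lim: "\<And>x. x \<in> X \<Longrightarrow> (\<lambda>n. \<phi> n x) \<longlonglongrightarrow> x"
  shows "(\<lambda>n. evidence \<pi>0 (push_kernel_at X k (\<phi> n) K) g T) \<longlonglongrightarrow> evidence \<pi>0 K g T"
proof -
  let ?f = "\<lambda>x. g k x * fut (T - k) x"
  obtain C where C: "\<And>x. x \<in> X \<Longrightarrow> 0 \<le> ?f x" "\<And>x. x \<in> X \<Longrightarrow> ?f x \<le> C"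
    using likelihood_future_bounded[OF k] by blast
  have f: "continuous_on X ?f"
    by (intro continuous_on_mult g continuous_on_future_likelihood cont) auto
  have sets: "sets (prd k) = sets M" using predictive_in_prob_algebra[OF k] by (simp add: space_prob_algebra)
  interpret prob_space "prd k" using predictive_in_prob_algebra[OF k] by (simp add: space_prob_algebra)
  have meas: "h \<in> borel_measurable (prd k)" if "h \<in> borel_measurable M" for h :: "'a \<Rightarrow> real"
    using that sets measurable_cong_sets by blast
  have \<phi>X: "\<phi> n x \<in> X" if "x \<in> X" for n x
    using measurable_space[OF \<phi>[of n], of x] that by simp
  have "(\<lambda>n. \<integral>x. ?f (\<phi> n x) \<partial>prd k) \<longlonglongrightarrow> (\<integral>x. ?f x \<partial>prd k)"
  proof (rule integral_dominated_convergence[where w="\<lambda>_. C"])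
    show "?f \<in> borel_measurable (prd k)"
      by (rule meas[OF likelihood_future_measurable[OF k]])
    show "(\<lambda>x. ?f (\<phi> n x)) \<in> borel_measurable (prd k)" for n
      by (rule meas[OF measurable_compose[OF \<phi> likelihood_future_measurable[OF k]]])
    show "AE x in prd k. (\<lambda>n. ?f (\<phi> n x)) \<longlonglongrightarrow> ?f x"
      using \<phi>X by (intro AE_I2 continuous_on_tendsto_compose[OF f lim]) (auto simp: predictive_space[OF k])
    show "AE x in prd k. norm (?f (\<phi> n x)) \<le> C" for n
      using C \<phi>X by (intro AE_I2) (auto simp: predictive_space[OF k] simp del: abs_mult)
  qed simp
  then show ?thesis
    unfolding evidence_push_kernel_at[OF k \<phi>] evidence_eq_predictive[OF k] by (intro tendsto_mult tendsto_const)
qed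

text \<open>At the last time the future likelihood is 1, so the comparison concerns
  \<open>g T\<close> alone. The remaining factors are positive and preserve strictness.\<close>

lemma evidence_less_push_kernel_at_last:
  assumes T: "1 \<le> T" and \<phi>: "\<phi> \<in> M \<rightarrow>\<^sub>M M"
    and le: "\<And>x. x \<in> X \<Longrightarrow> g T x \<le> g T (\<phi> x)"
    and A: "A \<in> sets M" "0 < measure (prd T) A" "\<And>x. x \<in> A \<Longrightarrow> g T x < g T (\<phi> x)"
  shows "evidence \<pi>0 K g T < evidence \<pi>0 (push_kernel_at X T \<phi> K) g T"
proof -
  have k: "T \<in> {1..T}" using T by simp
  have prd: "prd T \<in> space (prob_algebra M)" by (rule predictive_in_prob_algebra[OF k])
  interpret prob_space "prd T" using prd by (simp add: space_prob_algebra)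
  have \<phi>X: "\<phi> x \<in> X" if "x \<in> X" for x using measurable_space[OF \<phi>, of x] that by simp
  have gm: "g T \<in> borel_measurable M" using T by (rule likelihood_measurable)
  have "(\<integral>x. g T x \<partial>prd T) < (\<integral>x. g T (\<phi> x) \<partial>prd T)"
  proof (rule integral_less_AE)
    show "integrable (prd T) (g T)" "integrable (prd T) (\<lambda>x. g T (\<phi> x))"
      using likelihood_pos[OF k] likelihood_le[OF k] \<phi>X gm measurable_compose[OF \<phi> gm]
      by (auto intro!: integrable_prob_algebra[OF prd, where C="B T"] simp: less_imp_le)
    show "emeasure (prd T) A \<noteq> 0" using A(2) by (simp add: emeasure_eq_measure)
    show "A \<in> sets (prd T)" using A(1) prd by (simp add: space_prob_algebra)
    show "AE x in prd T. x \<in> A \<longrightarrow> g T x \<noteq> g T (\<phi> x)" using A(3) by (intro AE_I2) (auto simp: less_le)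
    show "AE x in prd T. g T x \<le> g T (\<phi> x)" using le by (intro AE_I2) (auto simp: predictive_space[OF k])
  qed
  moreover have "0 < (\<Prod>s = 1..T - 1. \<integral>x. g s x \<partial>prd s)"
    by (intro prod_pos ballI predictive_likelihood_pos) auto
  ultimately show ?thesis
    unfolding evidence_push_kernel_at[OF k \<phi>] evidence_eq_predictive[OF k] by simp
qed

end

text \<open>The image measure of \<open>F\<close> is the original measure of a preimage. Setwise
  continuity thus survives each nudge and can be carried through the backward induction.\<close>

lemma (in positive_model) continuous_measure_push_kernel_at:
  assumes \<phi>: "\<phi> \<in> M \<rightarrow>\<^sub>M M"
    and cont: "\<And>t F. t \<in> {1..T} \<Longrightarrow> F \<in> sets M \<Longrightarrow> continuous_on X (\<lambda>x. measure (K t x) F)"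
    and t: "t \<in> {1..T}" and F: "F \<in> sets M"
  shows "continuous_on X (\<lambda>x. measure (push_kernel_at X k \<phi> K t x) F)"
proof (cases "t = k")
  case True
  have "measure (distr (K t x) M \<phi>) F = measure (K t x) (\<phi> -` F \<inter> X)" if "x \<in> X" for x
  proof -
    have "sets (K t x) = sets M"
      using kernel_in_prob_algebra[of t x] that t by (simp add: space_prob_algebra)
    then have "\<phi> \<in> K t x \<rightarrow>\<^sub>M M" using \<phi> measurable_cong_sets by blast
    then show ?thesis using F kernel_space[of t x] that t by (simp add: measure_distr)
  qed
  moreover have "\<phi> -` F \<inter> X \<in> sets M" using measurable_sets[OF \<phi> F] by simp
  ultimately show ?thesis using cont[OF t] True by (simp add: push_kernel_at_def cong: continuous_on_cong)
next
  case False
  then show ?thesis using cont[OF t F] by (simp add: push_kernel_at_def)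
qed

section \<open>Backward choice of the nudging parameters\<close>

lemma continuous_on_lipschitz_norm:
  fixes h :: "'a::real_normed_vector \<Rightarrow> 'b::real_normed_vector"
  assumes "\<And>x y. norm (h x - h y) \<le> L * norm (x - y)"
  shows "continuous_on S h"
\<comment> \<open>\<open>lipschitz_on\<close> asks for a nonnegative constant, whereas the sign of
  \<open>L\<close> is not given; hence the absolute value.\<close>
proof (rule lipschitz_on_continuous_on[of "\<bar>L\<bar>"], rule lipschitz_onI)
  show "dist (h x) (h y) \<le> \<bar>L\<bar> * dist x y" for x y
    using assms[of x y] mult_right_mono[OF abs_ge_self[of L] norm_ge_zero[of "x - y"]] by (simp add: dist_norm)
qed simp

theorem corollary3p4:
  fixes X :: "'a::euclidean_space set"
    and \<pi>0 :: "'a measure"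
    and K :: "nat \<Rightarrow> 'a \<Rightarrow> 'a measure"
    and g :: "nat \<Rightarrow> 'a \<Rightarrow> real"
    and T :: nat
    and \<Gamma> L :: "nat \<Rightarrow> real"
  assumes model: "state_space_model X \<pi>0 K g"
    and g_pos: "\<And>t x. t \<in> {1..T} \<Longrightarrow> 0 < g t x"
    and g_bounded: "\<And>t. t \<in> {1..T} \<Longrightarrow> bounded (range (g t))"
    and g_diff: "\<And>t x. t \<in> {1..T} \<Longrightarrow> (\<lambda>z. ln (g t z)) differentiable (at x)"
    and \<Gamma>_pos: "\<And>t. t \<in> {1..T} \<Longrightarrow> 0 < \<Gamma> t"
    and nudge_range: "\<And>t x \<gamma>. t \<in> {1..T} \<Longrightarrow> x \<in> X \<Longrightarrow> \<gamma> \<in> {0..\<Gamma> t}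
          \<Longrightarrow> gradient_nudge g t x \<gamma> \<in> X"
    and gradient_lipschitz: "\<And>t x x'. t \<in> {1..T} \<Longrightarrow>
          norm (gradient (\<lambda>z. ln (g t z)) x - gradient (\<lambda>z. ln (g t z)) x') \<le> L t * norm (x - x')"
    and gradient_nonzero: "\<And>t. t \<in> {1..T} \<Longrightarrow>
          \<exists>A\<in>sets (restrict_space borel X). 0 < measure (predictive_measure \<pi>0 K g t) A \<and>
            (\<forall>x\<in>A. gradient (\<lambda>z. ln (g t z)) x \<noteq> 0)"
    and kernel_tv_continuous: "\<And>t x \<epsilon>. t \<in> {1..T} \<Longrightarrow> x \<in> X \<Longrightarrow> 0 < \<epsilon> \<Longrightarrow>
          \<exists>\<delta>>0. \<forall>x'\<in>X. norm (x - x') \<le> \<delta> \<longrightarrow>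
            tv_norm (sets (restrict_space borel X))
              (\<lambda>F. measure (K t x) F - measure (K t x') F) \<le> \<epsilon>"
  shows "\<exists>\<gamma> :: nat \<Rightarrow> real. (\<forall>t\<in>{1..T}. 0 < \<gamma> t \<and> \<gamma> t \<le> \<Gamma> t) \<and>
           evidence \<pi>0 (nudged_kernel X (gradient_nudge g) \<gamma> K) g T \<ge> evidence \<pi>0 K g T"
proof (cases "T = 0")
  case True
  then show ?thesis by (simp add: evidence_def)
next
  case False
  then have T: "1 \<le> T" "T \<in> {1..T}" by auto
  have "\<forall>t\<in>{1..T}. \<exists>b. \<forall>x. g t x \<le> b"
    using g_bounded unfolding bounded_iff by (fastforce simp: abs_le_iff)
  then obtain B where B: "\<And>t x. t \<in> {1..T} \<Longrightarrow> g t x \<le> B t" by metis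
  interpret positive_model X \<pi>0 K g T B
    using model g_pos B by (auto simp: positive_model_def positive_model_axioms_def)
  have K_cont: "continuous_on X (\<lambda>x. measure (K t x) F)" if t: "t \<in> {1..T}" and "F \<in> sets M" for t F
    using t that kernel_in_prob_algebra[of t]
    by (intro setwise_continuous_of_tv[where \<A>="sets M"] kernel_tv_continuous) (auto simp: space_prob_algebra)
  have g_cont: "continuous_on X (g t)" if t: "t \<in> {1..T}" for t
  proof -
    \<comment> \<open>Differentiability is assumed of the logarithm, so \<open>g t\<close> is
      written as its exponential.\<close>
    have "continuous_on X (\<lambda>x. exp (ln (g t x)))"
      using g_diff[OF t] by (intro continuous_on_exp continuous_at_imp_continuous_on ballI differentiable_imp_continuous_within) auto
    then show ?thesis using g_pos[OF t] by simp
  qed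
  have nudge_measurable: "(\<lambda>x. gradient_nudge g t x \<epsilon>) \<in> M \<rightarrow>\<^sub>M M"
    if t: "t \<in> {1..T}" and \<epsilon>: "\<epsilon> \<in> {0..\<Gamma> t}" for t \<epsilon>
  proof (rule measurable_restrict_space2)
    have "continuous_on UNIV (\<lambda>x. gradient_nudge g t x \<epsilon>)" unfolding gradient_nudge_def
      by (intro continuous_intros continuous_on_lipschitz_norm[OF gradient_lipschitz[OF t]])
    then show "(\<lambda>x. gradient_nudge g t x \<epsilon>) \<in> M \<rightarrow>\<^sub>M borel"
      by (intro measurable_restrict_space1 borel_measurable_continuous_onI)
  qed (use nudge_range[OF t _ \<epsilon>] in auto)

  \<comment> \<open>\<open>K'\<close> is the model nudged exactly at the times after
    \<open>k\<close> up to \<open>T\<close>. The inequality is kept strict to leave slack for the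
    next nudge, which may lower the evidence slightly.\<close>
  have "\<exists>\<gamma> K'. positive_model X \<pi>0 K' g T B
      \<and> (\<forall>t\<in>{1..T}. \<forall>F\<in>sets M. continuous_on X (\<lambda>x. measure (K' t x) F))
      \<and> (\<forall>t\<in>{1..k}. K' t = K t)
      \<and> (\<forall>t\<in>{k<..T}. 0 < \<gamma> t \<and> \<gamma> t \<le> \<Gamma> t \<and> K' t = nudged_kernel X (gradient_nudge g) \<gamma> K t)
      \<and> evidence \<pi>0 K g T < evidence \<pi>0 K' g T" if "k \<le> T - 1" for k
    using that
  proof (induction rule: inc_induct)
    case base
    \<comment> \<open>The added 1 avoids division by 0 and still gives
      \<open>\<epsilon> * L T \<le> 1\<close>.\<close>
    define \<epsilon> where "\<epsilon> = min (\<Gamma> T) (1 / (\<bar>L T\<bar> + 1))"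
    let ?\<phi> = "\<lambda>x. gradient_nudge g T x \<epsilon>"
    let ?K = "push_kernel_at X T ?\<phi> K"
    have \<epsilon>: "0 < \<epsilon>" "\<epsilon> \<le> \<Gamma> T" using \<Gamma>_pos[OF T(2)] by (auto simp: \<epsilon>_def)
    have "\<epsilon> * L T \<le> \<epsilon> * (\<bar>L T\<bar> + 1)" using \<epsilon>(1) by (intro mult_left_mono) auto
    also have "\<dots> \<le> 1 / (\<bar>L T\<bar> + 1) * (\<bar>L T\<bar> + 1)"
      by (intro mult_right_mono) (auto simp: \<epsilon>_def)
    also have "\<dots> = 1" by (simp add: add_nonneg_eq_0_iff)
    finally have L: "\<epsilon> * L T \<le> 1" .
    have \<phi>: "?\<phi> \<in> M \<rightarrow>\<^sub>M M" using T(2) \<epsilon> by (intro nudge_measurable) auto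
    \<comment> \<open>The ascent step increases \<open>ln (g T x)\<close>, and positivity transfers
      this to \<open>g T\<close> itself.\<close>
    have less: "g T x < g T (?\<phi> x)" if "gradient (\<lambda>z. ln (g T z)) x \<noteq> 0" for x
      using gradient_ascent_less[OF g_diff[OF T(2)] gradient_lipschitz[OF T(2)] that \<epsilon>(1) L] g_pos[OF T(2)]
      by (simp add: gradient_nudge_def)
    \<comment> \<open>Where the gradient vanishes the nudge fixes the point.\<close>
    then have le: "g T x \<le> g T (?\<phi> x)" for x
      by (cases "gradient (\<lambda>z. ln (g T z)) x = 0") (auto simp: gradient_nudge_def less_imp_le)
    \<comment> \<open>The last time is nudged first, while all kernels are still the original ones,
      so \<open>prd T\<close> is the very measure in the hypothesis.\<close>
    obtain A where "A \<in> sets M" "0 < measure (prd T) A" "\<And>x. x \<in> A \<Longrightarrow> gradient (\<lambda>z. ln (g T z)) x \<noteq> 0"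
      using gradient_nonzero[OF T(2)] by blast
    then have "evidence \<pi>0 K g T < evidence \<pi>0 ?K g T"
      using less le by (intro evidence_less_push_kernel_at_last[OF T(1) \<phi>]) auto
    \<comment> \<open>The range contains only \<open>T\<close>, so a constant sequence of parameters
      serves here.\<close>
    moreover have "0 < \<epsilon> \<and> \<epsilon> \<le> \<Gamma> t \<and> ?K t = nudged_kernel X (gradient_nudge g) (\<lambda>_. \<epsilon>) K t"
      if "t \<in> {T - 1<..T}" for t
    proof -
      have "t = T" using that by auto
      then show ?thesis using \<epsilon> by (simp add: push_kernel_at_def nudged_kernel_def fun_eq_iff)
    qed
    moreover have "?K t = K t" if "t \<in> {1..T - 1}" for t
      using that by (auto simp: push_kernel_at_def)
    ultimately show ?case
      using push_kernel_at_model[OF \<phi>, of T] continuous_measure_push_kernel_at[OF \<phi> K_cont]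
      by (intro exI[of _ "\<lambda>_. \<epsilon>"] exI[of _ ?K]) blast
  next
    case (step k)
    then obtain \<gamma> K' where K': "positive_model X \<pi>0 K' g T B"
      and cont: "\<And>t F. t \<in> {1..T} \<Longrightarrow> F \<in> sets M \<Longrightarrow> continuous_on X (\<lambda>x. measure (K' t x) F)"
      and eq: "\<And>t. t \<in> {1..Suc k} \<Longrightarrow> K' t = K t"
      and \<gamma>: "\<And>t. t \<in> {Suc k<..T} \<Longrightarrow>
            0 < \<gamma> t \<and> \<gamma> t \<le> \<Gamma> t \<and> K' t = nudged_kernel X (gradient_nudge g) \<gamma> K t"
      and less: "evidence \<pi>0 K g T < evidence \<pi>0 K' g T"
      by blast
    interpret K': positive_model X \<pi>0 K' g T B by fact
    have k: "Suc k \<in> {1..T}" using step.hyps by auto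
    \<comment> \<open>Admissible positive parameters tending to 0; one of them becomes the parameter
      at time \<open>Suc k\<close>.\<close>
    define e where "e n = \<Gamma> (Suc k) / real (Suc n)" for n
    have e: "0 < e n" "e n \<le> \<Gamma> (Suc k)" for n
      using \<Gamma>_pos[OF k] by (auto simp: e_def divide_le_eq)
    let ?\<phi> = "\<lambda>n x. gradient_nudge g (Suc k) x (e n)"
    have \<phi>: "?\<phi> n \<in> M \<rightarrow>\<^sub>M M" for n using k e by (intro nudge_measurable) (auto simp: less_imp_le)
    have "e \<longlonglongrightarrow> 0" unfolding e_def
      using tendsto_mult[OF tendsto_const LIMSEQ_inverse_real_of_nat, of "\<Gamma> (Suc k)"] by (simp add: divide_inverse)
    then have "(\<lambda>n. ?\<phi> n x) \<longlonglongrightarrow> x + 0 *\<^sub>R gradient (\<lambda>z. ln (g (Suc k) z)) x" for x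
      unfolding gradient_nudge_def by (intro tendsto_intros)
    then have "(\<lambda>n. evidence \<pi>0 (push_kernel_at X (Suc k) (?\<phi> n) K') g T) \<longlonglongrightarrow> evidence \<pi>0 K' g T"
      by (intro K'.evidence_push_kernel_at_tendsto k cont g_cont \<phi>) auto
    \<comment> \<open>The limit lies strictly above the original evidence, hence so does some term
      of the sequence.\<close>
    then obtain n where n: "evidence \<pi>0 K g T < evidence \<pi>0 (push_kernel_at X (Suc k) (?\<phi> n) K') g T"
      using order_tendstoD(1)[OF _ less] eventually_happens'[OF sequentially_bot] by blast
    let ?K = "push_kernel_at X (Suc k) (?\<phi> n) K'" and ?\<gamma> = "\<gamma>(Suc k := e n)"
    have "0 < ?\<gamma> t \<and> ?\<gamma> t \<le> \<Gamma> t \<and> ?K t = nudged_kernel X (gradient_nudge g) ?\<gamma> K t"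
      if t: "t \<in> {k<..T}" for t
    proof (cases "t = Suc k")
      case True
      \<comment> \<open>\<open>K'\<close> still has the original kernel at \<open>Suc k\<close>, so
        pushing it forward gives the nudge of \<open>K\<close> and not of an altered kernel.\<close>
      then show ?thesis using e[of n] eq[of "Suc k"]
        by (simp add: push_kernel_at_def nudged_kernel_def fun_eq_iff)
    next
      case False
      then show ?thesis using \<gamma>[of t] t
        by (simp add: push_kernel_at_def nudged_kernel_def fun_eq_iff)
    qed
    moreover have "?K t = K t" if "t \<in> {1..k}" for t
      using that eq[of t] by (simp add: push_kernel_at_def)
    ultimately show ?case
      using K'.push_kernel_at_model[OF \<phi>, of "Suc k" n] K'.continuous_measure_push_kernel_at[OF \<phi> cont] n
      by (intro exI[of _ ?\<gamma>] exI[of _ ?K]) blast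
  qed
  \<comment> \<open>The induction is used at \<open>k = 0\<close>, where every time has been
    nudged.\<close>
  moreover have "{0<..T} = {1..T}" by auto
  ultimately obtain \<gamma> K' where K': "positive_model X \<pi>0 K' g T B"
    and \<gamma>: "\<And>t. t \<in> {1..T} \<Longrightarrow> 0 < \<gamma> t \<and> \<gamma> t \<le> \<Gamma> t \<and> K' t = nudged_kernel X (gradient_nudge g) \<gamma> K t"
    and less: "evidence \<pi>0 K g T < evidence \<pi>0 K' g T"
    by (metis zero_le)
  \<comment> \<open>The two families are known to agree only at times \<open>1\<close> to
    \<open>T\<close>, which are the ones that the evidence sees.\<close>
  have "evidence \<pi>0 (nudged_kernel X (gradient_nudge g) \<gamma> K) g T = evidence \<pi>0 K' g T"
    using \<gamma> by (intro positive_model.evidence_cong[OF K']) auto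
  then show ?thesis using \<gamma> less by (intro exI[of _ \<gamma>]) auto
qed

end
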